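(* Let $P,Q,P',Q'$ be integers and $M=\begin{pmatrix}P&P'\\Q&Q'\end{pmatrix}$. For each $x\in\Omega=[0,1]\setminus\mathbb Q$ the following are equivalent: (i) $P/Q$, $P'/Q'$ are successive convergents in $\mathrm{OCF}(x)$. (ii) $M\in\mathcal R_O$ and one of the following two conditions holds: ($\ast$) $\lambda_M>2+g$ and $0<|E_M(x)|<1$; ($\ast\ast$) $g<\lambda_M\leqslant2+g$ and $0<E_M(x)<1$.
   Context: Here $g=(\sqrt5-1)/2$. OCF expansion. Let $\mathbb N=\{1,2,\dots\}$, $D=\bigcup_{n\in 2\mathbb N}[\frac1{n+1},\frac1n)$. For $x\in\Omega$ put $e_D(x)=1$, $a_D(x)=[1/x]$, $T_D(x)=\{1/x\}$ if $x\notin D$, and $e_D(x)=-1$, $a_D(x)=1+[1/x]$, $T_D(x)=1-\{1/x\}$ if $x\in D$ (integer and fractional parts $[\cdot]$, $\{\cdot\}$). For $x\in\Omega$ set $t_n=T_D^n(x)$, $e_0=1$, and for $n\ge1$: $e_n=e_D(t_{n-1})$, $a_n=a_D(t_{n-1})$ (all $a_n$ are odd positive integers with $a_n+e_n\ge2$). The convergents $p_n/q_n$ of $\mathrm{OCF}(x)$ are given by $p_{-1}=1$, $p_0=0$, $p_n=a_np_{n-1}+e_{n-1}p_{n-2}$, $q_{-1}=0$, $q_0=1$, $q_n=a_nq_{n-1}+e_{n-1}q_{n-2}$ for $n\ge1$. "$P/Q,P'/Q'$ are successive convergents in $\mathrm{OCF}(x)$" means that $P=p_{n-1}$, $Q=q_{n-1}$,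 $P'=p_n$, $Q'=q_n$ for some $n\ge1$. Let $I=\begin{pmatrix}1&0\\0&1\end{pmatrix}$, $A=\begin{pmatrix}0&1\\1&1\end{pmatrix}$, $B=\begin{pmatrix}1&1\\1&0\end{pmatrix}$. For $M=\begin{pmatrix}P&P'\\Q&Q'\end{pmatrix}$ put $\lambda_M=Q'/Q$ and, for $x\notin\mathbb Q$, $E_M(x)=\dfrac{Q'x-P'}{-Qx+P}$. $\mathcal R_O$ is the set of $M\in\mathrm{GL}_2(\mathbb Z)$ with $0\leqslant P\leqslant Q$, $1\leqslant P'\leqslant Q'$, $\lambda_M>g$, and $M\equiv I$, $A$ or $B\pmod2$ (entrywise). *)

theory Defs
  imports "HOL-Analysis.Analysis"
begin

definition g :: real where
  "g = (sqrt 5 - 1) / 2"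

definition Omega :: "real set" where
  "Omega = {0..1} - \<rat>"

definition D :: "real set" where
  "D = (\<Union>n\<in>{n::nat. even n \<and> 1 \<le> n}. {1 / real (n + 1) ..< 1 / real n})"

definition e_D :: "real \<Rightarrow> int" where
  "e_D x = (if x \<in> D then -1 else 1)"

definition a_D :: "real \<Rightarrow> int" where
  "a_D x = (if x \<in> D then 1 + \<lfloor>1 / x\<rfloor> else \<lfloor>1 / x\<rfloor>)"

definition T_D :: "real \<Rightarrow> real" where
  "T_D x = (if x \<in> D then 1 - frac (1 / x) else frac (1 / x))"

definition ocf_t :: "real \<Rightarrow> nat \<Rightarrow> real" where
  "ocf_t x n = (T_D ^^ n) x"

definition ocf_e :: "real \<Rightarrow> nat \<Rightarrow> int" where
  "ocf_e x n = (if n = 0 then 1 else e_D (ocf_t x (n - 1)))"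

text \<open>The partial quotients \<open>a\<^sub>n\<close> are defined for \<open>n \<ge> 1\<close>; the value at \<open>n = 0\<close> is irrelevant.\<close>
definition ocf_a :: "real \<Rightarrow> nat \<Rightarrow> int" where
  "ocf_a x n = a_D (ocf_t x (n - 1))"

text \<open>In \<open>ocf_p\<close> and \<open>ocf_q\<close> the second equation is the recurrence at \<open>n = 1\<close> with the initial
  values \<open>p\<^sub>-\<^sub>1 = 1\<close> and \<open>q\<^sub>-\<^sub>1 = 0\<close> inserted, so that the index can range over \<open>nat\<close>.\<close>
fun ocf_p :: "real \<Rightarrow> nat \<Rightarrow> int" where
  "ocf_p x 0 = 0"
| "ocf_p x (Suc 0) = ocf_a x 1 * ocf_p x 0 + ocf_e x 0 * 1"
| "ocf_p x (Suc (Suc n)) =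
     ocf_a x (Suc (Suc n)) * ocf_p x (Suc n) + ocf_e x (Suc n) * ocf_p x n"

fun ocf_q :: "real \<Rightarrow> nat \<Rightarrow> int" where
  "ocf_q x 0 = 1"
| "ocf_q x (Suc 0) = ocf_a x 1 * ocf_q x 0 + ocf_e x 0 * 0"
| "ocf_q x (Suc (Suc n)) =
     ocf_a x (Suc (Suc n)) * ocf_q x (Suc n) + ocf_e x (Suc n) * ocf_q x n"

text \<open>The condition is on the pairs of numerator and denominator, not only on the two quotients.\<close>
definition successive_convergents :: "real \<Rightarrow> int \<Rightarrow> int \<Rightarrow> int \<Rightarrow> int \<Rightarrow> bool" where
  "successive_convergents x P Q P' Q' \<longleftrightarrow>
     (\<exists>n\<ge>1. P = ocf_p x (n - 1) \<and> Q = ocf_q x (n - 1) \<and> P' = ocf_p x n \<and> Q' = ocf_q x n)"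

text \<open>\<open>mat2\<close> lists the entries row by row.\<close>
definition mat2 :: "int \<Rightarrow> int \<Rightarrow> int \<Rightarrow> int \<Rightarrow> int^2^2" where
  "mat2 a b c d = vector [vector [a, b], vector [c, d]]"

definition GL2Z :: "(int^2^2) set" where
  "GL2Z = {M. invertible M}"

definition mat_cong2 :: "int^2^2 \<Rightarrow> int^2^2 \<Rightarrow> bool" where
  "mat_cong2 M N \<longleftrightarrow> (\<forall>i j. M $ i $ j mod 2 = N $ i $ j mod 2)"

definition lam :: "int^2^2 \<Rightarrow> real" where
  "lam M = real_of_int (M $ 2 $ 2) / real_of_int (M $ 2 $ 1)"

definition E_map :: "int^2^2 \<Rightarrow> real \<Rightarrow> real" where
  "E_map M x = (real_of_int (M $ 2 $ 2) * x - real_of_int (M $ 1 $ 2)) /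
               (- real_of_int (M $ 2 $ 1) * x + real_of_int (M $ 1 $ 1))"

text \<open>Membership forces \<open>M $ 2 $ 1 \<noteq> 0\<close> (otherwise the first column of \<open>M\<close> vanishes), so neither
  \<open>lam M\<close> nor, for irrational \<open>x\<close>, \<open>E_map M x\<close> involves a division by zero.\<close>
definition R_O :: "(int^2^2) set" where
  "R_O = {M \<in> GL2Z.
     0 \<le> M $ 1 $ 1 \<and> M $ 1 $ 1 \<le> M $ 2 $ 1 \<and>
     1 \<le> M $ 1 $ 2 \<and> M $ 1 $ 2 \<le> M $ 2 $ 2 \<and>
     lam M > g \<and>
     (mat_cong2 M (mat2 1 0 0 1) \<or> mat_cong2 M (mat2 0 1 1 1) \<or> mat_cong2 M (mat2 1 1 1 0))}"

end

theory Submission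
  imports Defs
begin

text \<open>If \<open>P/Q\<close> and \<open>P'/Q'\<close> are the convergents with indices \<open>n - 1\<close> and \<open>n\<close>, then
  \<open>E_M(x) = e\<^sub>n t\<^sub>n\<close> (\<open>ocf_remainder\<close>), so \<open>0 < \<bar>E_M(x)\<bar> < 1\<close> is automatic and the sign of \<open>E_M(x)\<close>
  is \<open>e\<^sub>n\<close>. Both conditions together therefore say that \<open>\<lambda> = Q'/Q\<close> exceeds \<open>g\<close>, and exceeds
  \<open>2 + g\<close> whenever \<open>E_M(x) < 0\<close>. Everything rests on the identities \<open>1 / g = 1 + g\<close> and
  \<open>1 / (2 + g) = 1 - g\<close>.

  Convergents satisfy these bounds: \<open>\<lambda>\<^sub>n\<^sub>+\<^sub>1 = a\<^sub>n\<^sub>+\<^sub>1 + e\<^sub>n / \<lambda>\<^sub>n\<close>, and if \<open>e\<^sub>n = -1\<close>, then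
  \<open>\<lambda>\<^sub>n > 2 + g\<close> costs at most \<open>1 - g\<close>, so that \<open>\<lambda>\<^sub>n\<^sub>+\<^sub>1 > a\<^sub>n\<^sub>+\<^sub>1 - 1 + g\<close>. This is at least \<open>g\<close>, and
  at least \<open>2 + g\<close> if \<open>e\<^sub>n\<^sub>+\<^sub>1 = -1\<close>, since then \<open>a\<^sub>n\<^sub>+\<^sub>1 \<ge> 3\<close> (\<open>ocf_recurrence_growth\<close>). The
  remaining conditions on \<open>M\<close> follow along the same recurrence; modulo \<open>2\<close> the matrices run
  through \<open>I, A, B\<close> cyclically.

  Conversely, let \<open>M\<close> satisfy the conditions. If \<open>M\<close> is to come from a smaller such matrix by
  appending a partial quotient \<open>a\<close> after the sign \<open>e\<close>, then \<open>\<lambda> = a + e / \<lambda>'\<close> must lie in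
  \<open>(a - 1 + g, a + 1 + g)\<close>. As \<open>a\<close> runs through the odd positive integers, these intervals tile
  \<open>(g, \<infinity>)\<close> up to irrational points, so \<open>a\<close> and \<open>e\<close> are determined by \<open>\<lambda>\<close>
  (\<open>odd_quotient\<close>). The smaller matrix lies in \<open>R_O\<close> again (\<open>ocf_reduced_descent\<close>); its remainder is
  \<open>e / (a + E_M(x))\<close> with \<open>a + E_M(x) > 1\<close>, so it satisfies the conditions too. By induction it
  consists of successive convergents, and the next partial quotient of \<open>x\<close> is \<open>a\<close> because an odd
  integer within distance \<open>1\<close> of \<open>1 / t\<close> is unique (\<open>ocf_digit_unique\<close>). The descent ends when
  \<open>Q' = a Q\<close>, and there the determinant and the parities leave only \<open>p\<^sub>0/q\<^sub>0\<close> and \<open>p\<^sub>1/q\<^sub>1\<close>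
  (\<open>ocf_reduced_base\<close>).\<close>

section \<open>The golden number\<close>

lemma g_square: "g * g = 1 - g"
  unfolding g_def by (simp add: field_simps)

lemma g_bounds: "1 / 2 < g" "g < 1"
proof -
  have "(2::real) < sqrt 5" "sqrt 5 < (3::real)"
    by (auto intro: real_less_rsqrt real_less_lsqrt)
  then show "1 / 2 < g" "g < 1"
    unfolding g_def by auto
qed

lemma g_irrational: "g \<notin> \<rat>"
proof
  assume "g \<in> \<rat>"
  then obtain m n :: nat where n: "n \<noteq> 0" and abs: "\<bar>g\<bar> = real m / real n" and cop: "coprime m n"
    by (rule Rats_abs_nat_div_natE)
  have "g = real m / real n" using abs g_bounds by linarith
  then have "g * real n = real m" using n by (metis nonzero_divide_eq_eq of_nat_0_eq_iff)
  then have "real m * real m + real m * real n = (g * g + g) * (real n * real n)"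
    by (simp add: algebra_simps)
  also have "\<dots> = real n * real n" using g_square by simp
  finally have "real (m * m + m * n) = real (n * n)" by simp
  then have "m * m + m * n = n * n" using of_nat_eq_iff by blast
  \<comment> \<open>the form \<open>m\<^sup>2 + m n - n\<^sup>2\<close> is even only for even \<open>m\<close> and \<open>n\<close>\<close>
  then have "even (m * m + m * n) \<longleftrightarrow> even (n * n)" by simp
  then have "even m" "even n" by auto
  then show False using cop by (metis coprime_common_divisor odd_one)
qed

lemma irrational_lin_neq:
  fixes y :: real and m n :: int
  assumes "y \<notin> \<rat>" "n \<noteq> 0"
  shows "of_int n * y \<noteq> of_int m"
proof
  assume "of_int n * y = of_int m"
  then have "y = of_int m / of_int n" using assms(2) by (simp add: field_simps)
  then show False using assms(1) by simp
qed

section \<open>One step of the expansion\<close>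

lemma Omega_bounds:
  assumes "t \<in> Omega"
  shows "0 < t" "t < 1" "t \<notin> \<rat>"
proof -
  have "0 \<le> t" "t \<le> 1" and irr: "t \<notin> \<rat>" using assms by (auto simp: Omega_def)
  moreover have "t \<noteq> 0" "t \<noteq> 1" using irr by auto
  ultimately show "0 < t" "t < 1" "t \<notin> \<rat>" by auto
qed

text \<open>For irrational \<open>t\<close> the half-open intervals of \<open>D\<close> only test the parity of \<open>\<lfloor>1 / t\<rfloor>\<close>.\<close>
lemma mem_D_iff:
  assumes "t \<in> Omega"
  shows "t \<in> D \<longleftrightarrow> even \<lfloor>1 / t\<rfloor>"
proof -
  note t = Omega_bounds[OF assms]
  define k where "k = \<lfloor>1 / t\<rfloor>"
  have "1 / t \<notin> \<rat>" using t(3) Rats_inverse[of "1 / t"] by (auto simp: inverse_eq_divide)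
  then have "1 / t \<noteq> of_int k" by (metis Rats_of_int)
  then have k: "of_int k < 1 / t" "1 / t < of_int k + 1" unfolding k_def by linarith+
  have "1 \<le> k" unfolding k_def using t by simp
  have interval: "t \<in> {1 / real (n + 1) ..< 1 / real n} \<longleftrightarrow> int n = k" if "n \<ge> 1" for n
  proof -
    have "t \<in> {1 / real (n + 1) ..< 1 / real n} \<longleftrightarrow> real n < 1 / t \<and> 1 / t \<le> real n + 1"
      using t that by (auto simp: field_simps)
    also have "\<dots> \<longleftrightarrow> int n = k"
    proof
      assume "real n < 1 / t \<and> 1 / t \<le> real n + 1"
      then have "real_of_int (int n) < of_int k + 1" "real_of_int k < of_int (int n) + 1"
        using k by auto
      then show "int n = k" by linarith
    next
      assume "int n = k"
      then have "real n = of_int k" by simp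
      then show "real n < 1 / t \<and> 1 / t \<le> real n + 1" using k by simp
    qed
    finally show ?thesis .
  qed
  have "t \<in> D \<longleftrightarrow> (\<exists>n. even n \<and> 1 \<le> n \<and> int n = k)"
    unfolding D_def using interval by auto
  also have "\<dots> \<longleftrightarrow> even k"
  proof
    assume "even k"
    then have "even (nat k)" "1 \<le> nat k" "int (nat k) = k"
      using \<open>1 \<le> k\<close> by (auto simp: even_nat_iff)
    then show "\<exists>n. even n \<and> 1 \<le> n \<and> int n = k" by blast
  qed auto
  finally show ?thesis unfolding k_def .
qed

lemma ocf_digit:
  assumes "t \<in> Omega"
  shows "odd (a_D t)" "1 \<le> a_D t" "e_D t = 1 \<or> e_D t = -1" "e_D t = -1 \<Longrightarrow> 3 \<le> a_D t"
    "T_D t \<in> Omega" "1 / t = of_int (a_D t) + of_int (e_D t) * T_D t"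
proof -
  note t = Omega_bounds[OF assms]
  have "1 \<le> \<lfloor>1 / t\<rfloor>" using t by simp
  then show "odd (a_D t)" "1 \<le> a_D t" "e_D t = 1 \<or> e_D t = -1"
    using mem_D_iff[OF assms] t(1) by (auto simp: a_D_def e_D_def)
  show "3 \<le> a_D t" if "e_D t = -1"
  proof -
    have "even \<lfloor>1 / t\<rfloor>" and a: "a_D t = 1 + \<lfloor>1 / t\<rfloor>"
      using that mem_D_iff[OF assms] by (auto simp: a_D_def e_D_def split: if_splits)
    then have "\<lfloor>1 / t\<rfloor> \<noteq> 1" by auto
    then show ?thesis using a \<open>1 \<le> \<lfloor>1 / t\<rfloor>\<close> by linarith
  qed
  show eq: "1 / t = of_int (a_D t) + of_int (e_D t) * T_D t"
    by (auto simp: a_D_def e_D_def T_D_def frac_def)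
  have "T_D t \<notin> \<rat>"
  proof
    assume "T_D t \<in> \<rat>"
    then have "1 / t \<in> \<rat>" unfolding eq by simp
    then show False using t(3) Rats_inverse[of "1 / t"] by (auto simp: inverse_eq_divide)
  qed
  moreover have "0 \<le> T_D t" "T_D t \<le> 1"
    using frac_lt_1[of "1 / t"] by (auto simp: T_D_def less_imp_le)
  ultimately show "T_D t \<in> Omega" by (simp add: Omega_def)
qed

text \<open>Both \<open>a\<close> and \<open>a_D t\<close> are odd and at distance less than \<open>1\<close> from \<open>1 / t\<close>.\<close>
lemma ocf_digit_unique:
  assumes "t \<in> Omega" "odd a" "1 / t = of_int a + E" "\<bar>E\<bar> < 1"
  shows "a_D t = a"
proof -
  note d = ocf_digit[OF assms(1)]
  have "\<bar>of_int (e_D t) * T_D t\<bar> < 1"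
    using d(3) Omega_bounds[OF d(5)] by auto
  then have "\<bar>of_int (a_D t) - real_of_int a\<bar> < 2"
    using d(6) assms(3,4) by linarith
  then have "\<bar>a_D t - a\<bar> < 2" by linarith
  moreover have "even (a_D t - a)" using d(1) assms(2) by simp
  ultimately show ?thesis by presburger
qed

section \<open>Growth of the convergents\<close>

lemma ocf_t_Suc: "ocf_t x (Suc n) = T_D (ocf_t x n)"
  by (simp add: ocf_t_def)

lemma ocf_a_Suc: "ocf_a x (Suc n) = a_D (ocf_t x n)"
  by (simp add: ocf_a_def)

lemma ocf_e_Suc: "ocf_e x (Suc n) = e_D (ocf_t x n)"
  by (simp add: ocf_e_def)

lemma ocf_t_in_Omega:
  assumes "x \<in> Omega"
  shows "ocf_t x n \<in> Omega"
proof (induction n)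
  case 0
  then show ?case using assms by (simp add: ocf_t_def)
next
  case (Suc n)
  then show ?case by (simp add: ocf_t_Suc ocf_digit)
qed

text \<open>The bounds for the ratio of consecutive terms reproduce themselves because
  \<open>a - 1 / c \<ge> a - 3 + c\<close>, and a negative next sign forces \<open>a \<ge> 3\<close>. The condition on \<open>c\<close> says
  \<open>2 \<le> c \<le> 2 + g\<close>. The choice \<open>c = 2 + g\<close> serves for \<open>p\<^sub>n\<close> and \<open>q\<^sub>n\<close>; for \<open>q\<^sub>n - p\<^sub>n\<close>, whose
  initial ratio is only \<open>a\<^sub>1 - 1\<close>, it is \<open>c = 2\<close>.\<close>
lemma ocf_recurrence_growth:
  fixes r :: "nat \<Rightarrow> int" and c :: real
  assumes x: "x \<in> Omega"
    and rec: "\<And>n. r (Suc (Suc n)) = ocf_a x (Suc (Suc n)) * r (Suc n) + ocf_e x (Suc n) * r n"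
    and c: "2 \<le> c" "c \<le> 3" "c * (3 - c) \<ge> 1"
    and r0: "0 \<le> r 0"
    and r1: "(c - 2) * r 0 \<le> r 1" "ocf_e x 1 = -1 \<Longrightarrow> c * r 0 \<le> r 1"
  shows "0 \<le> r n \<and> (c - 2) * r n \<le> r (Suc n) \<and> (ocf_e x (Suc n) = -1 \<longrightarrow> c * r n \<le> r (Suc n))"
proof (induction n)
  case 0
  then show ?case using r0 r1 by simp
next
  case (Suc n)
  define a where "a = ocf_a x (Suc (Suc n))"
  have a: "1 \<le> a" "ocf_e x (Suc (Suc n)) = -1 \<Longrightarrow> 3 \<le> a"
    using ocf_digit(2,4)[OF ocf_t_in_Omega[OF x, of "Suc n"]]
    by (simp_all add: a_def ocf_a_Suc ocf_e_Suc)
  have e: "ocf_e x (Suc n) = 1 \<or> ocf_e x (Suc n) = -1"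
    using ocf_digit(3)[OF ocf_t_in_Omega[OF x, of n]] by (simp add: ocf_e_Suc)
  have "0 \<le> (c - 2) * r n" using Suc c(1) by simp
  then have nonneg: "0 \<le> real_of_int (r (Suc n))" using Suc by linarith
  have "(of_int a - 3 + c) * r (Suc n) \<le> of_int a * r (Suc n) + ocf_e x (Suc n) * r n"
    using e
  proof
    assume e1: "ocf_e x (Suc n) = 1"
    have "(c - 3) * r (Suc n) \<le> 0" using c(2) nonneg by (simp add: mult_nonpos_nonneg)
    then show ?thesis using Suc e1 by (simp add: algebra_simps)
  next
    assume e1: "ocf_e x (Suc n) = -1"
    then have "c * r n \<le> r (Suc n)" using Suc by simp
    then have "(3 - c) * (c * r n) \<le> (3 - c) * r (Suc n)"
      using c(2) by (intro mult_left_mono) auto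
    moreover have "1 * real_of_int (r n) \<le> (c * (3 - c)) * r n"
      using c(3) Suc by (intro mult_right_mono) auto
    ultimately show ?thesis using e1 by (simp add: algebra_simps)
  qed
  also have "\<dots> = r (Suc (Suc n))" by (simp add: rec a_def)
  finally have lower: "(of_int a - 3 + c) * r (Suc n) \<le> r (Suc (Suc n))" .
  have "(c - 2) * r (Suc n) \<le> (of_int a - 3 + c) * r (Suc n)"
    using a(1) nonneg by (intro mult_right_mono) auto
  moreover have "c * r (Suc n) \<le> (of_int a - 3 + c) * r (Suc n)" if "ocf_e x (Suc (Suc n)) = -1"
    using a(2)[OF that] nonneg by (intro mult_right_mono) auto
  ultimately show ?case using lower nonneg by force
qed

text \<open>The last inequality is the equation \<open>(2 + g) * (1 - g) = 1\<close>.\<close>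
lemma growth_constant:
  "2 \<le> 2 + g" "2 + g \<le> 3" "(2 + g) * (3 - (2 + g)) \<ge> 1"
  using g_bounds g_square by (auto simp: algebra_simps)

lemma ocf_q_growth:
  assumes "x \<in> Omega"
  shows "0 \<le> ocf_q x n \<and> g * ocf_q x n \<le> ocf_q x (Suc n) \<and>
    (ocf_e x (Suc n) = -1 \<longrightarrow> (2 + g) * ocf_q x n \<le> ocf_q x (Suc n))"
proof -
  have "1 \<le> ocf_a x 1" "ocf_e x 1 = -1 \<Longrightarrow> 3 \<le> ocf_a x 1"
    using ocf_digit(2,4)[OF assms] by (simp_all add: ocf_a_def ocf_e_def ocf_t_def)
  then have "0 \<le> ocf_q x n \<and> (2 + g - 2) * ocf_q x n \<le> ocf_q x (Suc n) \<and>
    (ocf_e x (Suc n) = -1 \<longrightarrow> (2 + g) * ocf_q x n \<le> ocf_q x (Suc n))"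
    using g_bounds by (intro ocf_recurrence_growth[OF assms _ growth_constant]) force+
  then show ?thesis by simp
qed

lemma ocf_p_growth:
  assumes "x \<in> Omega"
  shows "0 \<le> ocf_p x n \<and> g * ocf_p x n \<le> ocf_p x (Suc n)"
proof -
  have "0 \<le> ocf_p x n \<and> (2 + g - 2) * ocf_p x n \<le> ocf_p x (Suc n) \<and>
    (ocf_e x (Suc n) = -1 \<longrightarrow> (2 + g) * ocf_p x n \<le> ocf_p x (Suc n))"
    by (intro ocf_recurrence_growth[OF assms _ growth_constant]) (auto simp: ocf_e_def)
  then show ?thesis by simp
qed

lemma ocf_p_pos:
  assumes "x \<in> Omega"
  shows "1 \<le> ocf_p x (Suc n)"
proof (induction n)
  case 0
  then show ?case by (simp add: ocf_e_def)
next
  case (Suc n)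
  then have "0 < g * ocf_p x (Suc n)" using g_bounds by simp
  then have "0 < real_of_int (ocf_p x (Suc (Suc n)))"
    using ocf_p_growth[OF assms, of "Suc n"] by linarith
  then show ?case by linarith
qed

lemma ocf_p_le_q:
  assumes "x \<in> Omega"
  shows "ocf_p x n \<le> ocf_q x n"
proof -
  define r where "r n = ocf_q x n - ocf_p x n" for n
  have "1 \<le> ocf_a x 1" "ocf_e x 1 = -1 \<Longrightarrow> 3 \<le> ocf_a x 1"
    using ocf_digit(2,4)[OF assms] by (simp_all add: ocf_a_def ocf_e_def ocf_t_def)
  then have "0 \<le> r n \<and> (2 - 2 :: real) * r n \<le> r (Suc n) \<and>
    (ocf_e x (Suc n) = -1 \<longrightarrow> (2 :: real) * r n \<le> r (Suc n))"
    by (intro ocf_recurrence_growth[OF assms]) (auto simp: r_def ocf_e_def algebra_simps)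
  then show ?thesis by (simp add: r_def)
qed

lemma ocf_q_pos:
  assumes "x \<in> Omega"
  shows "1 \<le> ocf_q x n"
proof (cases n)
  case (Suc m)
  then show ?thesis using ocf_p_pos[OF assms, of m] ocf_p_le_q[OF assms, of n] by simp
qed simp

section \<open>The matrices of successive convergents\<close>

text \<open>Two by two integer matrices are invertible exactly if the determinant is a unit of \<open>\<int>\<close>.\<close>
lemma mat2_in_GL2Z_iff: "mat2 a b c d \<in> GL2Z \<longleftrightarrow> \<bar>a * d - b * c\<bar> = 1"
proof
  assume "mat2 a b c d \<in> GL2Z"
  then obtain N where "mat2 a b c d ** N = mat 1"
    unfolding GL2Z_def invertible_def by blast
  then have "det (mat2 a b c d) * det N = 1"
    by (metis det_mul det_I)
  then have "\<bar>det (mat2 a b c d)\<bar> = 1" by (metis dvd_triv_left zdvd1_eq)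
  then show "\<bar>a * d - b * c\<bar> = 1" by (simp add: det_2 mat2_def)
next
  assume det: "\<bar>a * d - b * c\<bar> = 1"
  define s where "s = a * d - b * c"
  define N where "N = mat2 (s * d) (- s * b) (- s * c) (s * a)"
  have "s * s = 1" using det unfolding s_def[symmetric] by (auto simp: abs_if split: if_splits)
  then have s: "s * (a * d) - s * (b * c) = 1"
    unfolding s_def by (simp add: algebra_simps)
  have "mat2 a b c d ** N = mat 1" "N ** mat2 a b c d = mat 1"
    using s by (simp_all add: N_def vec_eq_iff forall_2 matrix_matrix_mult_def sum_2 mat2_def
        mat_def algebra_simps)
  then show "mat2 a b c d \<in> GL2Z"
    unfolding GL2Z_def invertible_def by blast
qed

text \<open>Membership in \<open>R_O\<close> in terms of the entries, which are taken row by row: numerators, then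
  denominators. The last conjunct lists the parities of the matrices congruent to \<open>I\<close>, \<open>A\<close> and
  \<open>B\<close>, in this order.\<close>
definition ocf_reduced :: "int \<Rightarrow> int \<Rightarrow> int \<Rightarrow> int \<Rightarrow> bool" where
  "ocf_reduced P P' Q Q' \<longleftrightarrow> \<bar>P * Q' - P' * Q\<bar> = 1 \<and>
     0 \<le> P \<and> P \<le> Q \<and> 1 \<le> P' \<and> P' \<le> Q' \<and> g * Q < Q' \<and>
     (odd P \<and> even P' \<and> even Q \<and> odd Q' \<or>
      even P \<and> odd P' \<and> odd Q \<and> odd Q' \<or>
      odd P \<and> odd P' \<and> odd Q \<and> even Q')"

lemma det_imp_Q_pos:
  fixes P Q P' Q' :: int
  assumes "\<bar>P * Q' - P' * Q\<bar> = 1" "0 \<le> P" "P \<le> Q"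
  shows "1 \<le> Q"
proof (rule ccontr)
  assume "\<not> 1 \<le> Q"
  then have "P = 0" "Q = 0" using assms by auto
  then show False using assms(1) by simp
qed

lemma mat2_in_R_O_iff: "mat2 P P' Q Q' \<in> R_O \<longleftrightarrow> ocf_reduced P P' Q Q'"
proof -
  have lam: "lam (mat2 P P' Q Q') > g \<longleftrightarrow> g * Q < Q'" if "1 \<le> Q"
    using that by (simp add: lam_def mat2_def field_simps)
  have "even m \<longleftrightarrow> m mod 2 = 0" "odd m \<longleftrightarrow> m mod 2 = 1" for m :: int by presburger+
  then have par: "(mat_cong2 (mat2 P P' Q Q') (mat2 1 0 0 1) \<or>
      mat_cong2 (mat2 P P' Q Q') (mat2 0 1 1 1) \<or> mat_cong2 (mat2 P P' Q Q') (mat2 1 1 1 0)) \<longleftrightarrow>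
     (odd P \<and> even P' \<and> even Q \<and> odd Q' \<or>
      even P \<and> odd P' \<and> odd Q \<and> odd Q' \<or>
      odd P \<and> odd P' \<and> odd Q \<and> even Q')"
    unfolding mat_cong2_def by (simp add: forall_2 mat2_def)
  have entries: "mat2 P P' Q Q' $ 1 $ 1 = P" "mat2 P P' Q Q' $ 1 $ 2 = P'"
      "mat2 P P' Q Q' $ 2 $ 1 = Q" "mat2 P P' Q Q' $ 2 $ 2 = Q'"
    by (simp_all add: mat2_def)
  show ?thesis
    unfolding R_O_def ocf_reduced_def mem_Collect_eq par mat2_in_GL2Z_iff entries
    using lam det_imp_Q_pos by blast
qed

lemma ocf_det:
  assumes "x \<in> Omega"
  shows "\<bar>ocf_p x n * ocf_q x (Suc n) - ocf_p x (Suc n) * ocf_q x n\<bar> = 1"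
proof (induction n)
  case 0
  then show ?case by (simp add: ocf_e_def)
next
  case (Suc n)
  have "ocf_e x (Suc n) = 1 \<or> ocf_e x (Suc n) = -1"
    using ocf_digit(3)[OF ocf_t_in_Omega[OF assms, of n]] by (simp add: ocf_e_Suc)
  moreover have "ocf_p x (Suc n) * ocf_q x (Suc (Suc n)) - ocf_p x (Suc (Suc n)) * ocf_q x (Suc n)
     = - ocf_e x (Suc n) * (ocf_p x n * ocf_q x (Suc n) - ocf_p x (Suc n) * ocf_q x n)"
    by (simp add: algebra_simps)
  ultimately show ?case using Suc by (auto simp: abs_mult)
qed

lemma ocf_parity:
  defines "par \<equiv> \<lambda>P P' Q Q'::int. odd P \<and> even P' \<and> even Q \<and> odd Q' \<or>
      even P \<and> odd P' \<and> odd Q \<and> odd Q' \<or> odd P \<and> odd P' \<and> odd Q \<and> even Q'"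
  assumes "x \<in> Omega"
  shows "par (ocf_p x n) (ocf_p x (Suc n)) (ocf_q x n) (ocf_q x (Suc n))"
proof (induction n)
  case 0
  then show ?case
    using ocf_digit(1)[OF ocf_t_in_Omega[OF assms(2), of 0]] by (simp add: ocf_e_def par_def ocf_a_Suc)
next
  case (Suc n)
  have "odd (ocf_a x (Suc (Suc n)))"
    using ocf_digit(1)[OF ocf_t_in_Omega[OF assms(2), of "Suc n"]] by (simp add: ocf_a_Suc)
  moreover have "odd (ocf_e x (Suc n))"
    using ocf_digit(3)[OF ocf_t_in_Omega[OF assms(2), of n]] by (auto simp: ocf_e_Suc)
  ultimately show ?case using Suc unfolding par_def by auto
qed

lemma ocf_convergents_reduced:
  assumes "x \<in> Omega"
  shows "ocf_reduced (ocf_p x n) (ocf_p x (Suc n)) (ocf_q x n) (ocf_q x (Suc n))"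
proof -
  have "g * ocf_q x n \<noteq> ocf_q x (Suc n)"
    using irrational_lin_neq[OF g_irrational, of "ocf_q x n" "ocf_q x (Suc n)"]
      ocf_q_pos[OF assms, of n] by (simp add: mult.commute)
  then have "g * ocf_q x n < ocf_q x (Suc n)"
    using ocf_q_growth[OF assms, of n] by simp
  then show ?thesis
    unfolding ocf_reduced_def
    using ocf_det[OF assms, of n] ocf_p_growth[OF assms, of n] ocf_p_le_q[OF assms]
      ocf_p_pos[OF assms, of n] ocf_parity[OF assms, of n] by blast
qed

text \<open>Division-free form of \<open>E_M(x) = e\<^sub>n t\<^sub>n\<close>.\<close>
lemma ocf_remainder:
  assumes "x \<in> Omega"
  shows "of_int (ocf_e x (Suc n)) * ocf_t x (Suc n) * (of_int (ocf_p x n) - of_int (ocf_q x n) * x)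
    = of_int (ocf_q x (Suc n)) * x - of_int (ocf_p x (Suc n))"
proof (induction n)
  case 0
  have "1 / x = of_int (a_D x) + of_int (e_D x) * T_D x" by (rule ocf_digit(6)[OF assms])
  then show ?case
    using Omega_bounds[OF assms] by (simp add: ocf_e_def ocf_a_def ocf_t_def field_simps)
next
  case (Suc n)
  define t where "t = ocf_t x (Suc n)"
  define E where "E = of_int (e_D t) * T_D t"
  define e where "e = real_of_int (ocf_e x (Suc n))"
  have t: "t \<in> Omega" unfolding t_def by (rule ocf_t_in_Omega[OF assms])
  have "1 / t = of_int (a_D t) + E" unfolding E_def by (rule ocf_digit(6)[OF t])
  then have tE: "t * (of_int (a_D t) + E) = 1" using Omega_bounds[OF t] by (simp add: field_simps)
  have "e = 1 \<or> e = -1"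
    using ocf_digit(3)[OF ocf_t_in_Omega[OF assms, of n]] by (auto simp: e_def ocf_e_Suc)
  then have ee: "e * e = 1" by auto
  define u where "u = of_int (ocf_p x n) - of_int (ocf_q x n) * x"
  define v where "v = of_int (ocf_p x (Suc n)) - of_int (ocf_q x (Suc n)) * x"
  have "e * t * u = - v" using Suc by (simp add: e_def t_def u_def v_def)
  then have "e * (of_int (a_D t) + E) * (e * t * u) = e * (of_int (a_D t) + E) * (- v)" by simp
  moreover have "e * (of_int (a_D t) + E) * (e * t * u) = (e * e) * (t * (of_int (a_D t) + E)) * u"
    by (simp only: mult_ac)
  ultimately have "u = - e * (of_int (a_D t) + E) * v" using tE ee by simp
  then have "e * u = - (e * e) * (of_int (a_D t) + E) * v" by simp
  then have "E * v = - (of_int (a_D t) * v + e * u)" using ee by (simp add: algebra_simps)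
  then show ?case
    by (simp add: E_def v_def u_def e_def t_def ocf_e_Suc[of x "Suc n"] ocf_t_Suc[of x "Suc n"]
        ocf_a_Suc[of x "Suc n"] algebra_simps)
qed

lemma successive_convergents_iff:
  "successive_convergents x P Q P' Q' \<longleftrightarrow>
    (\<exists>n. P = ocf_p x n \<and> Q = ocf_q x n \<and> P' = ocf_p x (Suc n) \<and> Q' = ocf_q x (Suc n))"
proof
  assume "successive_convergents x P Q P' Q'"
  then obtain n where "n \<ge> 1" "P = ocf_p x (n - 1)" "Q = ocf_q x (n - 1)"
      "P' = ocf_p x n" "Q' = ocf_q x n"
    unfolding successive_convergents_def by blast
  then show "\<exists>n. P = ocf_p x n \<and> Q = ocf_q x n \<and> P' = ocf_p x (Suc n) \<and> Q' = ocf_q x (Suc n)"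
    by (intro exI[of _ "n - 1"]) auto
next
  assume "\<exists>n. P = ocf_p x n \<and> Q = ocf_q x n \<and> P' = ocf_p x (Suc n) \<and> Q' = ocf_q x (Suc n)"
  then show "successive_convergents x P Q P' Q'"
    unfolding successive_convergents_def by (metis diff_Suc_1 le_add1 plus_1_eq_Suc)
qed

section \<open>Descent\<close>

text \<open>The last partial quotient is read off from \<open>Q' / Q\<close> alone: the intervals
  \<open>(a - 1 + g, a + 1 + g)\<close> with \<open>a\<close> odd and positive tile \<open>(g, \<infinity>)\<close> up to irrational endpoints.\<close>
lemma odd_quotient:
  fixes Q Q' :: int
  assumes "1 \<le> Q" "g * Q < Q'"
  obtains a :: int where "odd a" "1 \<le> a" "(a - 1 + g) * Q < Q'" "Q' < (a + 1 + g) * Q"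
proof -
  define y where "y = (Q' / Q - g) / 2"
  define a where "a = 2 * \<lfloor>y\<rfloor> + 1"
  have "0 < y" using assms by (simp add: y_def field_simps)
  then have "0 \<le> \<lfloor>y\<rfloor>" by simp
  then have "odd a" "1 \<le> a" by (auto simp: a_def)
  have "real_of_int a - 1 \<le> 2 * y" "2 * y < real_of_int a + 1"
    unfolding a_def by (auto; linarith)+
  then have le: "(a - 1 + g) * Q \<le> Q'" and upper: "Q' < (a + 1 + g) * Q"
    using assms(1) by (auto simp: y_def field_simps)
  have "of_int Q * g \<noteq> of_int (Q' - (a - 1) * Q)"
    using irrational_lin_neq[OF g_irrational, of Q "Q' - (a - 1) * Q"] assms(1) by linarith
  then have "(a - 1 + g) * Q \<noteq> Q'" by (simp add: algebra_simps)
  then show ?thesis using that \<open>odd a\<close> \<open>1 \<le> a\<close> le upper by simp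
qed

text \<open>If \<open>Q\<close> divides \<open>Q'\<close>, then the determinant forces \<open>Q = 1\<close>, and for an odd quotient the
  parities exclude \<open>P = 1\<close>.\<close>
lemma ocf_reduced_base:
  assumes red: "ocf_reduced P P' Q Q'" and Q': "Q' = a * Q" and a: "odd a"
  shows "P = 0" "P' = 1" "Q = 1" "Q' = a"
proof -
  have det: "\<bar>P * Q' - P' * Q\<bar> = 1" and P: "0 \<le> P" "P \<le> Q" and "1 \<le> P'"
    using red unfolding ocf_reduced_def by blast+
  note Q = det_imp_Q_pos[OF det P]
  have "P * Q' - P' * Q = Q * (P * a - P')" using Q' by (simp add: algebra_simps)
  then have "Q dvd 1" using det by (metis dvd_triv_left dvd_abs_iff)
  then show "Q = 1" using Q by simp
  then show "Q' = a" using Q' by simp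
  have "P \<noteq> 1" using red a \<open>Q = 1\<close> \<open>Q' = a\<close> unfolding ocf_reduced_def by auto
  then show "P = 0" using P \<open>Q = 1\<close> by simp
  then show "P' = 1" using det \<open>Q = 1\<close> \<open>1 \<le> P'\<close> by simp
qed

text \<open>Removing the last partial quotient keeps the matrix reduced. The bounds for the new first
  column follow from the determinant, except if \<open>Q = 1\<close>. Then the bounds for the new ratio leave only
  \<open>Q'' = 1\<close> and \<open>e = 1\<close>; this contradicts the parities if \<open>P = 0\<close>, while for \<open>P = 1\<close> the bound
  \<open>P'' \<le> Q''\<close> is inherited from \<open>P' \<le> Q'\<close>.\<close>
lemma ocf_reduced_descent:
  fixes P P' Q Q' P'' Q'' a e :: int
  assumes red: "ocf_reduced P P' Q Q'" and a: "odd a" "1 \<le> a" and e: "e = 1 \<or> e = -1"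
    and P': "P' = a * P + e * P''" and Q': "Q' = a * Q + e * Q''" and Q'': "1 \<le> Q''"
    and ratio: "g * Q'' < Q" "e = -1 \<Longrightarrow> (2 + g) * Q'' < Q"
  shows "ocf_reduced P'' P Q'' Q"
proof -
  have det: "\<bar>P * Q' - P' * Q\<bar> = 1" and P: "0 \<le> P" "P \<le> Q" and P'1: "1 \<le> P'" "P' \<le> Q'"
    using red unfolding ocf_reduced_def by blast+
  note Q = det_imp_Q_pos[OF det P]
  have "P * Q' - P' * Q = - e * (P'' * Q - P * Q'')"
    using P' Q' by (simp add: algebra_simps)
  then have det': "\<bar>P'' * Q - P * Q''\<bar> = 1" using det e by (auto simp: abs_mult)
  have small: "Q'' = 1 \<and> e = 1" if "Q = 1"
  proof -
    have "real_of_int Q'' < 2"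
    proof (rule ccontr)
      assume "\<not> real_of_int Q'' < 2"
      then have "g * 2 \<le> g * Q''" using g_bounds by (intro mult_left_mono) linarith+
      moreover have "real_of_int Q = 1" using that by simp
      ultimately show False using ratio(1) g_bounds by linarith
    qed
    then have "Q'' = 1" using Q'' by linarith
    then show ?thesis using ratio(2) e that g_bounds by auto
  qed
  have "P \<noteq> 0"
  proof
    assume "P = 0"
    then have "\<bar>P' * Q\<bar> = 1" using det by simp
    then have "Q dvd 1" by (metis dvd_triv_right dvd_abs_iff)
    then have "Q = 1" using Q by simp
    then have "even Q'" using small Q' a by simp
    then show False using red \<open>P = 0\<close> unfolding ocf_reduced_def by auto
  qed
  then have P1: "1 \<le> P" using P by simp
  then have "1 * 1 \<le> P * Q''" using Q'' by (intro mult_mono) auto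
  then have "0 \<le> P'' * Q" using det' by linarith
  then have P''0: "0 \<le> P''" using Q by (simp add: zero_le_mult_iff)
  have P''Q'': "P'' \<le> Q''"
  proof (cases "Q = 1")
    case True
    then have "P = 1" using P P1 by simp
    have "P'' \<le> Q''" using small[OF True] P' Q' P'1 \<open>P = 1\<close> True by simp
    then show ?thesis .
  next
    case False
    have "P \<noteq> Q"
    proof
      assume "P = Q"
      then have "P * Q' - P' * Q = Q * (Q' - P')" by (simp add: algebra_simps)
      then have "Q dvd 1" using det by (metis dvd_triv_left dvd_abs_iff)
      then show False using Q False by simp
    qed
    then have "P * Q'' \<le> (Q - 1) * Q''" using P Q'' by (intro mult_right_mono) auto
    then have "P'' * Q \<le> Q'' * Q" using det' Q'' by (simp add: algebra_simps)
    then show ?thesis using Q by simp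
  qed
  have "odd e" using e by auto
  then have par: "odd P' \<longleftrightarrow> odd P \<noteq> odd P''" "odd Q' \<longleftrightarrow> odd Q \<noteq> odd Q''"
    using P' Q' a by auto
  show ?thesis
    using red det' P P1 P''0 P''Q'' ratio(1) par unfolding ocf_reduced_def by auto
qed

text \<open>Both alternatives of the characterisation say that a negative remainder \<open>E\<close> needs
  \<open>Q' > (2 + g) Q\<close>. Induction on \<open>Q + Q'\<close>; the smaller matrix has remainder \<open>e / (a + E)\<close>, and
  the recurrence appends the partial quotient \<open>a\<close> to it again.\<close>
lemma ocf_reduced_imp_successive:
  assumes x: "x \<in> Omega" and "ocf_reduced P P' Q Q'"
    and "E * (of_int P - of_int Q * x) = of_int Q' * x - of_int P'"
    and "0 < \<bar>E\<bar>" "\<bar>E\<bar> < 1" and "E < 0 \<Longrightarrow> (2 + g) * of_int Q < of_int Q'"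
  shows "\<exists>n. P = ocf_p x n \<and> Q = ocf_q x n \<and> P' = ocf_p x (Suc n) \<and> Q' = ocf_q x (Suc n)"
  using assms(2-)
proof (induction "nat (Q + Q')" arbitrary: P P' Q Q' E rule: less_induct)
  case less
  note red = less.prems(1) and rem = less.prems(2) and E = less.prems(3,4) and neg = less.prems(5)
  have det: "\<bar>P * Q' - P' * Q\<bar> = 1" and P: "0 \<le> P" "P \<le> Q" and gQ: "g * Q < Q'"
    using red unfolding ocf_reduced_def by blast+
  note Q = det_imp_Q_pos[OF det P]
  obtain a :: int where a: "odd a" "1 \<le> a"
    and lo: "(a - 1 + g) * Q < Q'" and hi: "Q' < (a + 1 + g) * Q"
    using odd_quotient[OF Q gQ] by blast
  have aE: "1 < of_int a + E"
  proof (cases "E < 0")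
    case True
    then have "(2 + g) * Q < (a + 1 + g) * Q" using neg hi by simp
    then have "1 < a" using Q by simp
    then have "2 \<le> real_of_int a" by simp
    then show ?thesis using E by linarith
  next
    case False
    moreover have "1 \<le> real_of_int a" using a by simp
    ultimately show ?thesis using E by linarith
  qed
  show ?case
  proof (cases "Q' = a * Q")
    case True
    note base = ocf_reduced_base[OF red True a(1)]
    have "1 / x = of_int a + E"
      using rem base Omega_bounds[OF x] by (simp add: field_simps)
    then have "a_D x = a" using ocf_digit_unique[OF x a(1)] E by blast
    then show ?thesis
      using base by (intro exI[of _ 0]) (simp add: ocf_e_def ocf_a_def ocf_t_def)
  next
    case False
    define e :: int where "e = (if Q' > a * Q then 1 else -1)"
    define Q'' where "Q'' = e * (Q' - a * Q)"
    define P'' where "P'' = e * (P' - a * P)"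
    have e: "e = 1 \<or> e = -1" by (simp add: e_def)
    have Q'': "1 \<le> Q''" using False by (auto simp: e_def Q''_def)
    have P'_eq: "P' = a * P + e * P''" and Q'_eq: "Q' = a * Q + e * Q''"
      using e by (auto simp: P''_def Q''_def)
    have Q'_real: "real_of_int Q' = a * Q + e * Q''" by (simp add: Q'_eq)
    \<comment> \<open>\<open>1 / g = 1 + g\<close> and \<open>1 / (2 + g) = 1 - g\<close>\<close>
    have ratio_neg: "(2 + g) * Q'' < Q" if "e = -1"
    proof -
      have "real_of_int Q'' < (1 - g) * Q" using lo Q'_real that by (simp add: algebra_simps)
      then have "(2 + g) * Q'' < (2 + g) * ((1 - g) * Q)"
        using g_bounds by (intro mult_strict_left_mono) auto
      also have "\<dots> = (2 - g - g * g) * Q" by (simp add: algebra_simps)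
      finally show ?thesis by (simp add: g_square)
    qed
    have ratio: "g * Q'' < Q"
      using e
    proof
      assume "e = 1"
      then have "real_of_int Q'' < (1 + g) * Q" using hi Q'_real by (simp add: algebra_simps)
      then have "g * Q'' < g * ((1 + g) * Q)"
        using g_bounds by (intro mult_strict_left_mono) auto
      also have "\<dots> = (g + g * g) * Q" by (simp add: algebra_simps)
      finally show ?thesis by (simp add: g_square)
    next
      assume "e = -1"
      then show ?thesis using ratio_neg Q'' by (simp add: algebra_simps)
    qed
    have "Q \<le> a * Q" using a Q by simp
    have "Q'' < Q'"
      using e
    proof
      assume "e = -1"
      then have "2 * real_of_int Q'' + g * Q'' < Q" using ratio_neg by (simp add: algebra_simps)
      moreover have "0 < g * Q''" using Q'' g_bounds by simp
      ultimately have "2 * Q'' < Q" by linarith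
      then show ?thesis using Q'_eq \<open>e = -1\<close> \<open>Q \<le> a * Q\<close> by simp
    next
      assume "e = 1"
      then show ?thesis using Q'_eq \<open>Q \<le> a * Q\<close> Q by simp
    qed
    then have smaller: "nat (Q'' + Q) < nat (Q + Q')" using Q Q'' by simp
    have red': "ocf_reduced P'' P Q'' Q"
      by (rule ocf_reduced_descent[OF red a e P'_eq Q'_eq Q'' ratio ratio_neg])
    define E' where "E' = of_int e / (of_int a + E)"
    have "(of_int a + E) * (of_int P - of_int Q * x) = of_int e * (of_int Q'' * x - of_int P'')"
      using rem by (simp add: P'_eq Q'_eq algebra_simps)
    then have "of_int P - of_int Q * x = of_int e * (of_int Q'' * x - of_int P'') / (of_int a + E)"
      using aE by (simp add: field_simps)
    then have rem': "E' * (of_int P'' - of_int Q'' * x) = of_int Q * x - of_int P"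
      using aE by (simp add: E'_def field_simps)
    have E': "0 < \<bar>E'\<bar>" "\<bar>E'\<bar> < 1" using e aE by (auto simp: E'_def)
    have neg': "(2 + g) * Q'' < Q" if "E' < 0"
      using that ratio_neg e aE by (auto simp: E'_def)
    obtain n where n: "P'' = ocf_p x n" "Q'' = ocf_q x n" "P = ocf_p x (Suc n)" "Q = ocf_q x (Suc n)"
      using less.hyps[OF smaller red' rem' E' neg'] by blast
    define t where "t = ocf_t x (Suc n)"
    have t: "t \<in> Omega" unfolding t_def by (rule ocf_t_in_Omega[OF x])
    have "of_int P'' - of_int Q'' * x \<noteq> 0"
      using irrational_lin_neq[OF Omega_bounds(3)[OF x], of Q'' P''] Q'' by simp
    moreover have "of_int (ocf_e x (Suc n)) * t * (of_int P'' - of_int Q'' * x)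
        = E' * (of_int P'' - of_int Q'' * x)"
      unfolding rem' unfolding n t_def by (rule ocf_remainder[OF x])
    ultimately have signed: "of_int (ocf_e x (Suc n)) * t = E'"
      by (metis mult_right_cancel)
    define u where "u = 1 / (of_int a + E)"
    have "0 < u" using aE by (simp add: u_def)
    moreover have "E' = of_int e * u" by (simp add: E'_def u_def)
    moreover have "ocf_e x (Suc n) = 1 \<or> ocf_e x (Suc n) = -1"
      using ocf_digit(3)[OF ocf_t_in_Omega[OF x, of n]] by (simp add: ocf_e_Suc)
    moreover have "0 < t" using Omega_bounds[OF t] by simp
    ultimately have e_eq: "ocf_e x (Suc n) = e" and t_eq: "t = u"
      using signed e by auto
    have "1 / t = of_int a + E" using t_eq by (simp add: u_def)
    then have "a_D t = a" using ocf_digit_unique[OF t a(1)] E by blast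
    then have "ocf_a x (Suc (Suc n)) = a" by (simp add: ocf_a_Suc t_def)
    then have "P' = ocf_p x (Suc (Suc n))" "Q' = ocf_q x (Suc (Suc n))"
      using P'_eq Q'_eq n e_eq by simp_all
    then show ?thesis using n by (intro exI[of _ "Suc n"]) simp
  qed
qed

section \<open>The characterisation of successive convergents\<close>

theorem proposition3p4:
  fixes P Q P' Q' :: int and M :: "int^2^2" and x :: real
  assumes "M = mat2 P P' Q Q'"
    and "x \<in> Omega"
  shows "successive_convergents x P Q P' Q' \<longleftrightarrow>
    M \<in> R_O \<and>
    ((lam M > 2 + g \<and> 0 < \<bar>E_map M x\<bar> \<and> \<bar>E_map M x\<bar> < 1) \<or>
     (g < lam M \<and> lam M \<le> 2 + g \<and> 0 < E_map M x \<and> E_map M x < 1))"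
proof -
  have M_iff: "M \<in> R_O \<longleftrightarrow> ocf_reduced P P' Q Q'"
    using assms(1) mat2_in_R_O_iff by simp
  have lam: "lam M > 2 + g \<longleftrightarrow> (2 + g) * Q < Q'" "lam M > g" and
    rem: "E_map M x = E \<longleftrightarrow> E * (of_int P - of_int Q * x) = of_int Q' * x - of_int P'"
    if red: "ocf_reduced P P' Q Q'" for E
  proof -
    have Q: "1 \<le> Q" and gQ: "g * Q < Q'"
      using red det_imp_Q_pos unfolding ocf_reduced_def by blast+
    show "lam M > 2 + g \<longleftrightarrow> (2 + g) * Q < Q'" "lam M > g"
      using Q gQ by (simp_all add: lam_def assms(1) mat2_def field_simps)
    have "of_int P - of_int Q * x \<noteq> 0"
      using irrational_lin_neq[OF Omega_bounds(3)[OF assms(2)], of Q P] Q by simp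
    moreover have "E_map M x = (of_int Q' * x - of_int P') / (of_int P - of_int Q * x)"
      by (simp add: E_map_def assms(1) mat2_def)
    ultimately show "E_map M x = E \<longleftrightarrow>
        E * (of_int P - of_int Q * x) = of_int Q' * x - of_int P'"
      by (metis nonzero_divide_eq_eq)
  qed
  have "successive_convergents x P Q P' Q' \<longleftrightarrow> ocf_reduced P P' Q Q' \<and>
      0 < \<bar>E_map M x\<bar> \<and> \<bar>E_map M x\<bar> < 1 \<and> (E_map M x < 0 \<longrightarrow> (2 + g) * Q < Q')"
  proof
    assume "successive_convergents x P Q P' Q'"
    then obtain n where n: "P = ocf_p x n" "Q = ocf_q x n"
        "P' = ocf_p x (Suc n)" "Q' = ocf_q x (Suc n)"
      unfolding successive_convergents_iff by blast
    define t where "t = ocf_t x (Suc n)"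
    have t: "0 < t" "t < 1"
      unfolding t_def using Omega_bounds[OF ocf_t_in_Omega[OF assms(2)]] by blast+
    have red: "ocf_reduced P P' Q Q'"
      unfolding n by (rule ocf_convergents_reduced[OF assms(2)])
    have E: "E_map M x = of_int (ocf_e x (Suc n)) * t"
      using rem[OF red] ocf_remainder[OF assms(2), of n] n by (simp add: t_def)
    have e: "ocf_e x (Suc n) = 1 \<or> ocf_e x (Suc n) = -1"
      using ocf_digit(3)[OF ocf_t_in_Omega[OF assms(2), of n]] by (simp add: ocf_e_Suc)
    \<comment> \<open>irrationality of \<open>g\<close> makes the lower bound for \<open>\<lambda>\<close> strict\<close>
    have "1 \<le> Q" unfolding n by (rule ocf_q_pos[OF assms(2)])
    then have "of_int Q * g \<noteq> of_int (Q' - 2 * Q)"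
      using irrational_lin_neq[OF g_irrational, of Q "Q' - 2 * Q"] by simp
    then have "(2 + g) * Q \<noteq> Q'" by (simp add: algebra_simps)
    then have "(2 + g) * Q < Q'" if "ocf_e x (Suc n) = -1"
      using ocf_q_growth[OF assms(2), of n] that n by simp
    then show "ocf_reduced P P' Q Q' \<and>
      0 < \<bar>E_map M x\<bar> \<and> \<bar>E_map M x\<bar> < 1 \<and> (E_map M x < 0 \<longrightarrow> (2 + g) * Q < Q')"
      using red E e t by auto
  next
    assume "ocf_reduced P P' Q Q' \<and>
      0 < \<bar>E_map M x\<bar> \<and> \<bar>E_map M x\<bar> < 1 \<and> (E_map M x < 0 \<longrightarrow> (2 + g) * Q < Q')"
    then show "successive_convergents x P Q P' Q'"
      unfolding successive_convergents_iff
      using ocf_reduced_imp_successive[OF assms(2)] rem by blast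
  qed
  also have "\<dots> \<longleftrightarrow> M \<in> R_O \<and>
    ((lam M > 2 + g \<and> 0 < \<bar>E_map M x\<bar> \<and> \<bar>E_map M x\<bar> < 1) \<or>
     (g < lam M \<and> lam M \<le> 2 + g \<and> 0 < E_map M x \<and> E_map M x < 1))"
    using M_iff lam by (smt (verit))
  finally show ?thesis .
qed

end
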